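(* Let $\mathfrak{g}$ be the N=1 Heisenberg-Virasoro superalgebra, $\mathfrak{h}=\mathbb{C}L_0\oplus\mathbb{C}H_0$, $\lambda\in\mathbb{C}^*$ and $\beta$ a one-variable complex polynomial. On $M=\mathbb{C}[x,y]\oplus\mathbb{C}[s,t]$ define, for $f(x,y)\in\mathbb{C}[x,y]$, $f(s,t)\in\mathbb{C}[s,t]$, $m\in\mathbb{Z}$, $p\in\mathbb{Z}+\frac12$, $i=1,2,3$: $$L_mf(x,y)=\lambda^m(x+m\beta(y))f(x+m,y),\qquad L_mf(s,t)=\lambda^m\big(s+m(\beta(t)+\tfrac12)\big)f(s+m,t),$$ $$H_mf(x,y)=\lambda^myf(x+m,y),\qquad H_mf(s,t)=\lambda^mtf(s+m,t),$$ $$G_pf(x,y)=\lambda^{p-\frac12}f(s+p,t),\qquad G_pf(s,t)=\lambda^{p+\frac12}(x+2p\beta(y))f(x+p,y),$$ $$Q_pf(s,t)=\lambda^{p+\frac12}yf(x+p,y),\qquad Q_pf(x,y)=C_if(x,y)=C_if(s,t)=0.$$ Then $M$ is a $\mathfrak{g}$-module under these actions, and it is free of rank $2$ as a $U(\mathfrak{h})$-module.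
   Context: All vector spaces are over $\mathbb{C}$; all modules over Lie superalgebras are $\mathbb{Z}_2$-graded. Here the even part of $M$ is $\mathbb{C}[x,y]$ and the odd part is $\mathbb{C}[s,t]$; for a two-variable polynomial $f$, expressions such as $f(s+p,t)$ or $f(x+p,y)$ mean substitution into $f$. $\mathbb{C}^*$ is the set of nonzero complex numbers and $U(\mathfrak{h})=\mathbb{C}[L_0,H_0]$ is the universal enveloping algebra. The N=1 Heisenberg-Virasoro superalgebra $\mathfrak{g}$ is the Lie superalgebra with basis $L_m,H_m,C_1,C_2,C_3$ (even, $m\in\mathbb{Z}$) and $G_p,Q_p$ (odd, $p\in\mathbb{Z}+\frac12$), and brackets, for $m,n\in\mathbb{Z}$, $p,q\in\mathbb{Z}+\frac12$, $[L_m,L_n]=(m-n)L_{m+n}+\delta_{m+n,0}\frac{m^3-m}{12}C_1$, $[L_m,H_n]=-nH_{m+n}+\delta_{m+n,0}(m^2+m)C_2$, $[H_m,H_n]=m\delta_{m+n,0}C_3$, $[L_m,G_p]=(\frac m2-p)G_{m+p}$, $[L_m,Q_p]=-(\frac m2+p)Q_{m+p}$, $[H_m,G_p]=mQ_{m+p}$, $[G_p,G_q]=2L_{p+q}+\delta_{p+q,0}\frac{4p^2-1}{12}C_1$, $[G_p,Q_q]=H_{p+q}+(2p+1)\delta_{p+q,0}C_2$, $[Q_p,Q_q]=\delta_{p+q,0}C_3$, $[H_m,Q_p]=[\mathfrak{g},C_i]=0$. *)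

theory Defs
  imports Complex_Main "HOL-Library.Poly_Mapping" "HOL-Library.Product_Plus" "HOL-Library.Z2"
    "HOL-Computational_Algebra.Polynomial"
begin

section \<open>Lie superalgebras and their modules\<close>

text \<open>\<open>V i\<close> is the homogeneous component of parity \<open>i\<close>, with parities in the field \<^typ>\<open>bit\<close> of
  integers modulo 2.\<close>

locale superspace = vector_space scale
  for scale :: "complex \<Rightarrow> 'a::ab_group_add \<Rightarrow> 'a" +
  fixes V :: "bit \<Rightarrow> 'a set"
  assumes subspace_V: "subspace (V i)"
    and V_disjoint: "V 0 \<inter> V 1 = {0}"
    and V_decompose: "\<exists>a\<in>V 0. \<exists>b\<in>V 1. x = a + b"

definition koszul_sign :: "bit \<Rightarrow> bit \<Rightarrow> complex" where
  "koszul_sign i j = (if i = 1 \<and> j = 1 then - 1 else 1)"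

locale lie_superalgebra = superspace scale V
  for scale :: "complex \<Rightarrow> 'a::ab_group_add \<Rightarrow> 'a" and V :: "bit \<Rightarrow> 'a set" +
  fixes bracket :: "'a \<Rightarrow> 'a \<Rightarrow> 'a"
  assumes bracket_linear_left: "Vector_Spaces.linear scale scale (\<lambda>x. bracket x y)"
    and bracket_linear_right: "Vector_Spaces.linear scale scale (bracket x)"
    and bracket_graded: "x \<in> V i \<Longrightarrow> y \<in> V j \<Longrightarrow> bracket x y \<in> V (i + j)"
    and bracket_skew: "x \<in> V i \<Longrightarrow> y \<in> V j \<Longrightarrow>
      bracket x y = - scale (koszul_sign i j) (bracket y x)"
    and bracket_jacobi: "x \<in> V i \<Longrightarrow> y \<in> V j \<Longrightarrow> z \<in> V k \<Longrightarrow>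
      bracket x (bracket y z) =
        bracket (bracket x y) z + scale (koszul_sign i j) (bracket y (bracket x z))"

locale lie_superalgebra_module =
  lie_superalgebra scale V bracket + M: superspace mscale W
  for scale :: "complex \<Rightarrow> 'a::ab_group_add \<Rightarrow> 'a" and V :: "bit \<Rightarrow> 'a set"
    and bracket :: "'a \<Rightarrow> 'a \<Rightarrow> 'a"
    and mscale :: "complex \<Rightarrow> 'm::ab_group_add \<Rightarrow> 'm" and W :: "bit \<Rightarrow> 'm set" +
  fixes act :: "'a \<Rightarrow> 'm \<Rightarrow> 'm"
  assumes act_linear_left: "Vector_Spaces.linear scale mscale (\<lambda>x. act x v)"
    and act_linear_right: "Vector_Spaces.linear mscale mscale (act x)"
    and act_graded: "x \<in> V i \<Longrightarrow> v \<in> W j \<Longrightarrow> act x v \<in> W (i + j)"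
    and act_bracket: "x \<in> V i \<Longrightarrow> y \<in> V j \<Longrightarrow>
      act (bracket x y) v = act x (act y v) - mscale (koszul_sign i j) (act y (act x v))"

definition free_of_rank :: "('r::comm_ring_1 \<Rightarrow> 'm::ab_group_add \<Rightarrow> 'm) \<Rightarrow> nat \<Rightarrow> bool" where
  "free_of_rank scale n \<longleftrightarrow> module scale \<and>
     (\<exists>B. finite B \<and> card B = n \<and> \<not> module.dependent scale B \<and> module.span scale B = UNIV)"


section \<open>The N=1 Heisenberg-Virasoro superalgebra\<close>

text \<open>The constructors \<open>bG k\<close> and \<open>bQ k\<close> stand for the odd generators with half-integral index
  \<open>k + 1/2\<close>, that is, for \<open>G\<^sub>p\<close> and \<open>Q\<^sub>p\<close> with \<open>p = half k\<close>. Hence \<open>p + q = 0\<close> for \<open>p = half j\<close>,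
  \<open>q = half k\<close> reads \<open>j + k + 1 = 0\<close>, and \<open>m + p\<close> has integer label \<open>m + k\<close> if \<open>p = half k\<close>.\<close>

datatype hv_basis = bL int | bH int | bG int | bQ int | bC1 | bC2 | bC3

definition half :: "int \<Rightarrow> complex" where
  "half k = of_int k + 1 / 2"

type_synonym hv = "hv_basis \<Rightarrow>\<^sub>0 complex"

definition hv_scale :: "complex \<Rightarrow> hv \<Rightarrow> hv" where
  "hv_scale c u = Poly_Mapping.map ((*) c) u"

fun basis_parity :: "hv_basis \<Rightarrow> bit" where
  "basis_parity (bG k) = 1"
| "basis_parity (bQ k) = 1"
| "basis_parity _ = 0"

definition hv_part :: "bit \<Rightarrow> hv set" where
  "hv_part i = {u. \<forall>a\<in>Poly_Mapping.keys u. basis_parity a = i}"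

abbreviation sg :: "hv_basis \<Rightarrow> complex \<Rightarrow> hv" where
  "sg \<equiv> Poly_Mapping.single"

text \<open>The brackets of basis elements in the reversed order are those forced by super
  skew-symmetry; all pairs not listed have bracket zero.\<close>

fun basis_bracket :: "hv_basis \<Rightarrow> hv_basis \<Rightarrow> hv" where
  "basis_bracket (bL m) (bL n) =
     sg (bL (m + n)) (of_int (m - n)) + (sg bC1 (of_int (m ^ 3 - m) / 12) when m + n = 0)"
| "basis_bracket (bL m) (bH n) =
     sg (bH (m + n)) (- of_int n) + (sg bC2 (of_int (m\<^sup>2 + m)) when m + n = 0)"
| "basis_bracket (bH n) (bL m) =
     - (sg (bH (m + n)) (- of_int n) + (sg bC2 (of_int (m\<^sup>2 + m)) when m + n = 0))"
| "basis_bracket (bH m) (bH n) = (sg bC3 (of_int m) when m + n = 0)"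
| "basis_bracket (bL m) (bG k) = sg (bG (m + k)) (of_int m / 2 - half k)"
| "basis_bracket (bG k) (bL m) = - sg (bG (m + k)) (of_int m / 2 - half k)"
| "basis_bracket (bL m) (bQ k) = sg (bQ (m + k)) (- (of_int m / 2 + half k))"
| "basis_bracket (bQ k) (bL m) = - sg (bQ (m + k)) (- (of_int m / 2 + half k))"
| "basis_bracket (bH m) (bG k) = sg (bQ (m + k)) (of_int m)"
| "basis_bracket (bG k) (bH m) = - sg (bQ (m + k)) (of_int m)"
| "basis_bracket (bG j) (bG k) =
     sg (bL (j + k + 1)) 2 + (sg bC1 ((4 * (half j)\<^sup>2 - 1) / 12) when j + k + 1 = 0)"
| "basis_bracket (bG j) (bQ k) =
     sg (bH (j + k + 1)) 1 + (sg bC2 (2 * half j + 1) when j + k + 1 = 0)"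
| "basis_bracket (bQ k) (bG j) =
     sg (bH (j + k + 1)) 1 + (sg bC2 (2 * half j + 1) when j + k + 1 = 0)"
| "basis_bracket (bQ j) (bQ k) = (sg bC3 1 when j + k + 1 = 0)"
| "basis_bracket _ _ = 0"

definition hv_bracket :: "hv \<Rightarrow> hv \<Rightarrow> hv" where
  "hv_bracket u v = (\<Sum>a\<in>Poly_Mapping.keys u. \<Sum>b\<in>Poly_Mapping.keys v.
     hv_scale (Poly_Mapping.lookup u a * Poly_Mapping.lookup v b) (basis_bracket a b))"

lemma lookup_hv_scale [simp]:
  "Poly_Mapping.lookup (hv_scale c u) a = c * Poly_Mapping.lookup u a"
  by (simp add: hv_scale_def Poly_Mapping.map.rep_eq when_def)

lemma vector_space_hv_scale: "vector_space hv_scale"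
  by unfold_locales (auto intro!: poly_mapping_eqI simp: lookup_add algebra_simps)

interpretation hv: vector_space hv_scale
  by (rule vector_space_hv_scale)

lemma hv_scale_single [simp]: "hv_scale c (sg a d) = sg a (c * d)"
  by (rule poly_mapping_eqI) (simp add: lookup_single when_def)

lemma hv_expand: "u = (\<Sum>a\<in>Poly_Mapping.keys u. hv_scale (Poly_Mapping.lookup u a) (sg a 1))"
  by (rule poly_mapping_eqI)
    (auto simp: lookup_sum lookup_single when_def sum.delta in_keys_iff if_distrib cong: if_cong)

lemma hv_bracket_superset:
  assumes "finite A" "Poly_Mapping.keys u \<subseteq> A" "finite B" "Poly_Mapping.keys v \<subseteq> B"
  shows "hv_bracket u v = (\<Sum>a\<in>A. \<Sum>b\<in>B.
     hv_scale (Poly_Mapping.lookup u a * Poly_Mapping.lookup v b) (basis_bracket a b))"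
proof -
  have "hv_bracket u v = (\<Sum>a\<in>Poly_Mapping.keys u. \<Sum>b\<in>B.
     hv_scale (Poly_Mapping.lookup u a * Poly_Mapping.lookup v b) (basis_bracket a b))"
    unfolding hv_bracket_def using assms
    by (intro sum.cong refl sum.mono_neutral_left) (auto simp: in_keys_iff)
  also have "\<dots> = (\<Sum>a\<in>A. \<Sum>b\<in>B.
     hv_scale (Poly_Mapping.lookup u a * Poly_Mapping.lookup v b) (basis_bracket a b))"
    using assms by (intro sum.mono_neutral_left) (auto simp: in_keys_iff)
  finally show ?thesis .
qed

lemma keys_hv_scale: "Poly_Mapping.keys (hv_scale c u) \<subseteq> Poly_Mapping.keys u"
  by (auto simp: in_keys_iff)

lemma hv_bracket_add_left: "hv_bracket (u + u') v = hv_bracket u v + hv_bracket u' v"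
proof -
  let ?A = "Poly_Mapping.keys u \<union> Poly_Mapping.keys u'" and ?B = "Poly_Mapping.keys v"
  show ?thesis
    using Poly_Mapping.keys_add[of u u']
    by (simp add: hv_bracket_superset[of ?A _ ?B] lookup_add algebra_simps sum.distrib)
qed

lemma hv_bracket_add_right: "hv_bracket v (u + u') = hv_bracket v u + hv_bracket v u'"
proof -
  let ?A = "Poly_Mapping.keys u \<union> Poly_Mapping.keys u'" and ?B = "Poly_Mapping.keys v"
  show ?thesis
    using Poly_Mapping.keys_add[of u u']
    by (simp add: hv_bracket_superset[of ?B _ ?A] lookup_add algebra_simps sum.distrib)
qed

lemma hv_bracket_scale_left: "hv_bracket (hv_scale c u) v = hv_scale c (hv_bracket u v)"
  by (simp add: hv_bracket_superset[of "Poly_Mapping.keys u" _ "Poly_Mapping.keys v"] keys_hv_scale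
      hv.scale_sum_right mult.assoc)

lemma hv_bracket_scale_right: "hv_bracket v (hv_scale c u) = hv_scale c (hv_bracket v u)"
  by (simp add: hv_bracket_superset[of "Poly_Mapping.keys v" _ "Poly_Mapping.keys u"] keys_hv_scale
      hv.scale_sum_right mult_ac)

lemma linear_hv_bracket_left: "Vector_Spaces.linear hv_scale hv_scale (\<lambda>u. hv_bracket u v)"
  by unfold_locales (simp_all add: hv_bracket_add_left hv_bracket_scale_left)

lemma linear_hv_bracket_right: "Vector_Spaces.linear hv_scale hv_scale (hv_bracket v)"
  by unfold_locales (simp_all add: hv_bracket_add_right hv_bracket_scale_right)

interpretation hvl: additive "\<lambda>u. hv_bracket u v" for v
  by unfold_locales (rule hv_bracket_add_left)

interpretation hvr: additive "hv_bracket v" for v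
  by unfold_locales (rule hv_bracket_add_right)

lemma hv_bracket_single [simp]:
  "hv_bracket (sg a c) (sg b d) = hv_scale (c * d) (basis_bracket a b)"
  by (simp add: hv_bracket_superset[of "{a}" _ "{b}"])

lemma hv_bracket_zero [simp]: "hv_bracket 0 v = 0" "hv_bracket v 0 = 0"
  by (simp_all add: hvl.zero hvr.zero)

lemma basis_bracket_part: "basis_bracket a b \<in> hv_part (basis_parity a + basis_parity b)"
proof -
  have "Poly_Mapping.lookup (basis_bracket a b) c \<noteq> 0 \<longrightarrow>
      basis_parity c = basis_parity a + basis_parity b" for c
    by (cases a; cases b)
      (auto simp: lookup_add lookup_minus lookup_single when_def split: if_splits)
  then show ?thesis
    by (auto simp: hv_part_def in_keys_iff)
qed

lemma half_index_sum_zero: "k + 1 = - j \<Longrightarrow> k = - j - 1" for j k :: int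
  by simp

lemma basis_bracket_skew:
  "basis_bracket a b = - hv_scale (koszul_sign (basis_parity a) (basis_parity b)) (basis_bracket b a)"
  by (cases a; cases b)
    (auto intro!: poly_mapping_eqI simp: koszul_sign_def lookup_add lookup_minus lookup_single
      when_def half_def add_eq_0_iff field_simps power2_eq_square power3_eq_cube
      dest!: half_index_sum_zero)

lemma hv_if:
  "hv_bracket u (if P then v else 0) = (if P then hv_bracket u v else 0)"
  "hv_bracket (if P then v else 0) u = (if P then hv_bracket v u else 0)"
  "hv_scale c (if P then v else 0) = (if P then hv_scale c v else 0)"
  "- (if P then v else 0) = (if P then - v else (0 :: hv))"
  "Poly_Mapping.lookup (if P then v else 0) b = (if P then Poly_Mapping.lookup v b else 0)"
  by simp_all

lemma basis_jacobi:
  "hv_bracket (sg a 1) (basis_bracket b c) =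
     hv_bracket (basis_bracket a b) (sg c 1) +
     hv_scale (koszul_sign (basis_parity a) (basis_parity b))
       (hv_bracket (sg b 1) (basis_bracket a c))"
  apply (rule poly_mapping_eqI)
  apply (cases a; cases b; cases c)
  apply (simp_all only: basis_bracket.simps basis_parity.simps)
  apply (simp_all add: koszul_sign_def hvl.add hvr.add hvl.minus hvr.minus hvl.diff hvr.diff when_def
      hv_if lookup_add lookup_minus lookup_single add_ac cong: if_cong split del: if_split)
  apply (auto simp: half_def field_simps power2_eq_square power3_eq_cube
      dest!: iffD2[OF eq_neg_iff_add_eq_0])
  done

lemma hv_part_induct [consumes 1, case_names zero add single]:
  assumes "x \<in> hv_part i" "P 0" "\<And>u v. P u \<Longrightarrow> P v \<Longrightarrow> P (u + v)"
    "\<And>a c. basis_parity a = i \<Longrightarrow> P (hv_scale c (sg a 1))"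
  shows "P x"
proof -
  have "P (\<Sum>a\<in>A. hv_scale (Poly_Mapping.lookup x a) (sg a 1))"
    if "finite A" "A \<subseteq> Poly_Mapping.keys x" for A
    using that
  proof induction
    case (insert a A)
    then show ?case
      using assms by (simp add: hv_part_def del: hv_scale_single)
  qed (use assms in simp)
  from this[of "Poly_Mapping.keys x"] show ?thesis
    using hv_expand[of x] by simp
qed

lemmas hv_bracket_linear =
  hv_bracket_add_left hv_bracket_add_right hv_bracket_scale_left hv_bracket_scale_right

lemma subspace_hv_part: "hv.subspace (hv_part i)"
  by (rule hv.subspaceI) (fastforce simp: hv_part_def in_keys_iff lookup_add)+

lemma basis_bracket_part_scale:
  "hv_bracket (hv_scale c (sg a 1)) (hv_scale d (sg b 1)) \<in>
     hv_part (basis_parity a + basis_parity b)"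
  unfolding hv_scale_single hv_bracket_single
  by (rule hv.subspace_scale[OF subspace_hv_part basis_bracket_part])

lemma hv_bracket_graded:
  assumes "x \<in> hv_part i" "y \<in> hv_part j"
  shows "hv_bracket x y \<in> hv_part (i + j)"
  using assms(1)
proof (induction rule: hv_part_induct)
  case (single a c)
  show ?case
    using assms(2)
  proof (induction rule: hv_part_induct)
    case (single b d)
    then show ?case
      using \<open>basis_parity a = i\<close> basis_bracket_part_scale[of c a d b] by metis
  qed (auto simp: hv_bracket_linear intro: hv.subspace_0 hv.subspace_add subspace_hv_part)
qed (auto simp: hv_bracket_linear intro: hv.subspace_0 hv.subspace_add subspace_hv_part)

lemma hv_bracket_skew:
  assumes "x \<in> hv_part i" "y \<in> hv_part j"
  shows "hv_bracket x y = - hv_scale (koszul_sign i j) (hv_bracket y x)"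
  using assms(1)
proof (induction rule: hv_part_induct)
  case (single a c)
  show ?case
    using assms(2)
  proof (induction rule: hv_part_induct)
    case (single b d)
    have "hv_bracket (sg a 1) (sg b 1) = - hv_scale (koszul_sign i j) (hv_bracket (sg b 1) (sg a 1))"
      using basis_bracket_skew[of a b] \<open>basis_parity a = i\<close> \<open>basis_parity b = j\<close> by simp
    then show ?case
      by (simp only: hv_bracket_linear) (simp add: mult_ac)
  qed (simp_all add: hv_bracket_linear hv.scale_right_distrib del: hv_scale_single)
qed (simp_all add: hv_bracket_linear hv.scale_right_distrib)

lemma hv_bracket_jacobi:
  assumes "x \<in> hv_part i" "y \<in> hv_part j" "z \<in> hv_part k"
  shows "hv_bracket x (hv_bracket y z) =
    hv_bracket (hv_bracket x y) z + hv_scale (koszul_sign i j) (hv_bracket y (hv_bracket x z))"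
  using assms(1)
proof (induction rule: hv_part_induct)
  case (single a c)
  show ?case
    using assms(2)
  proof (induction rule: hv_part_induct)
    case (single b d)
    show ?case
      using assms(3)
    proof (induction rule: hv_part_induct)
      case (single e f)
      have "hv_bracket (sg a 1) (hv_bracket (sg b 1) (sg e 1)) =
          hv_bracket (hv_bracket (sg a 1) (sg b 1)) (sg e 1) +
          hv_scale (koszul_sign i j) (hv_bracket (sg b 1) (hv_bracket (sg a 1) (sg e 1)))"
        using basis_jacobi[of a b e] \<open>basis_parity a = i\<close> \<open>basis_parity b = j\<close> by simp
      then show ?case
        by (simp only: hv_bracket_linear) (simp add: hv.scale_right_distrib mult_ac)
    qed (simp_all add: hv_bracket_linear hv.scale_right_distrib del: hv_scale_single)
  qed (simp_all add: hv_bracket_linear hv.scale_right_distrib del: hv_scale_single)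
qed (simp_all add: hv_bracket_linear hv.scale_right_distrib)

lemma hv_decompose: "\<exists>a\<in>hv_part 0. \<exists>b\<in>hv_part 1. x = a + b"
proof -
  let ?s = "\<lambda>i. \<Sum>a\<in>{a\<in>Poly_Mapping.keys x. basis_parity a = i}. sg a (Poly_Mapping.lookup x a)"
  have "?s i \<in> hv_part i" for i
    by (rule hv.subspace_sum[OF subspace_hv_part]) (auto simp: hv_part_def)
  moreover have "x = ?s 0 + ?s 1"
  proof -
    have "x = (\<Sum>a\<in>Poly_Mapping.keys x. sg a (Poly_Mapping.lookup x a))"
      using hv_expand[of x] by simp
    also have "Poly_Mapping.keys x = {a\<in>Poly_Mapping.keys x. basis_parity a = 0} \<union>
        {a\<in>Poly_Mapping.keys x. basis_parity a = 1}"
      by auto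
    also have "(\<Sum>a\<in>\<dots>. sg a (Poly_Mapping.lookup x a)) = ?s 0 + ?s 1"
      by (rule sum.union_disjoint) auto
    finally show ?thesis .
  qed
  ultimately show ?thesis by blast
qed

theorem lie_superalgebra_hv: "lie_superalgebra hv_scale hv_part hv_bracket"
proof (intro lie_superalgebra.intro superspace.intro superspace_axioms.intro
    lie_superalgebra_axioms.intro)
  show "hv_part 0 \<inter> hv_part 1 = {0}"
  proof -
    have "u = 0" if "u \<in> hv_part 0" "u \<in> hv_part 1" for u
      using that by (cases "Poly_Mapping.keys u = {}") (auto simp: hv_part_def)
    then show ?thesis
      by (auto simp: hv_part_def)
  qed
qed (fact vector_space_hv_scale subspace_hv_part hv_decompose linear_hv_bracket_left
    linear_hv_bracket_right | erule (1) hv_bracket_graded | erule (1) hv_bracket_skew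
    | erule (2) hv_bracket_jacobi)+

lemma h_abelian:
  "hv_bracket (sg (bL 0) 1) (sg (bL 0) 1) = 0" "hv_bracket (sg (bL 0) 1) (sg (bH 0) 1) = 0"
  "hv_bracket (sg (bH 0) 1) (sg (bH 0) 1) = 0"
  by (simp_all add: when_def)

section \<open>The module\<close>

text \<open>A two-variable polynomial in \<open>x, y\<close> (or in \<open>s, t\<close>) is a polynomial in \<open>x\<close> (or \<open>s\<close>) whose
  coefficients are polynomials in \<open>y\<close> (or \<open>t\<close>). A pair \<open>(f, g)\<close> stands for the sum of the even
  element \<open>f(x,y)\<close> and the odd element \<open>g(s,t)\<close>.\<close>

type_synonym poly2 = "complex poly poly"

definition var1 :: poly2 where "var1 = [:0, 1:]"

definition var2 :: poly2 where "var2 = [:[:0, 1:]:]"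

definition shift :: "complex \<Rightarrow> poly2 \<Rightarrow> poly2" where
  "shift a f = pcompose f (var1 + [:[:a:]:])"

definition cmul :: "complex \<Rightarrow> poly2 \<Rightarrow> poly2" where
  "cmul c f = smult [:c:] f"

definition mod_scale :: "complex \<Rightarrow> poly2 \<times> poly2 \<Rightarrow> poly2 \<times> poly2" where
  "mod_scale c v = (cmul c (fst v), cmul c (snd v))"

definition mod_part :: "bit \<Rightarrow> (poly2 \<times> poly2) set" where
  "mod_part i = (if i = 0 then {(f, 0) | f. True} else {(0, g) | g. True})"

text \<open>For \<open>p = half k\<close> the exponents \<open>p - 1/2\<close> and \<open>p + 1/2\<close> of \<open>\<lambda>\<close> are the integers \<open>k\<close> and
  \<open>k + 1\<close>. The one-variable polynomial \<open>\<beta>(y)\<close>, viewed in two variables, is \<open>[:\<beta>:]\<close>.\<close>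

fun basis_act :: "complex \<Rightarrow> complex poly \<Rightarrow> hv_basis \<Rightarrow> poly2 \<times> poly2 \<Rightarrow> poly2 \<times> poly2" where
  "basis_act lam \<beta> (bL m) (f, g) =
     (cmul (lam powi m) ((var1 + cmul (of_int m) [:\<beta>:]) * shift (of_int m) f),
      cmul (lam powi m) ((var1 + cmul (of_int m) ([:\<beta>:] + [:[:1 / 2:]:])) * shift (of_int m) g))"
| "basis_act lam \<beta> (bH m) (f, g) =
     (cmul (lam powi m) (var2 * shift (of_int m) f),
      cmul (lam powi m) (var2 * shift (of_int m) g))"
| "basis_act lam \<beta> (bG k) (f, g) =
     (cmul (lam powi (k + 1)) ((var1 + cmul (2 * half k) [:\<beta>:]) * shift (half k) g),
      cmul (lam powi k) (shift (half k) f))"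
| "basis_act lam \<beta> (bQ k) (f, g) =
     (cmul (lam powi (k + 1)) (var2 * shift (half k) g), 0)"
| "basis_act lam \<beta> bC1 (f, g) = (0, 0)"
| "basis_act lam \<beta> bC2 (f, g) = (0, 0)"
| "basis_act lam \<beta> bC3 (f, g) = (0, 0)"

definition hv_act :: "complex \<Rightarrow> complex poly \<Rightarrow> hv \<Rightarrow> poly2 \<times> poly2 \<Rightarrow> poly2 \<times> poly2" where
  "hv_act lam \<beta> u v =
     (\<Sum>a\<in>Poly_Mapping.keys u. mod_scale (Poly_Mapping.lookup u a) (basis_act lam \<beta> a v))"

text \<open>Since \<open>\<hh>\<close> is abelian (lemma \<open>h_abelian\<close>) with basis \<open>L\<^sub>0\<close>, \<open>H\<^sub>0\<close>, its universal enveloping algebra is the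
  polynomial ring in these two elements. It is encoded by \<^typ>\<open>complex poly poly\<close>, with \<open>L\<^sub>0\<close> the
  outer and \<open>H\<^sub>0\<close> the inner variable, and a polynomial acts on a module of the superalgebra by
  evaluation at the operators given by \<open>L\<^sub>0\<close> and \<open>H\<^sub>0\<close>.\<close>

definition Uh_act ::
  "(complex \<Rightarrow> 'm::ab_group_add \<Rightarrow> 'm) \<Rightarrow> (hv \<Rightarrow> 'm \<Rightarrow> 'm) \<Rightarrow> complex poly poly \<Rightarrow> 'm \<Rightarrow> 'm" where
  "Uh_act scale act P v = (\<Sum>i\<le>degree P. \<Sum>j\<le>degree (coeff P i).
     scale (coeff (coeff P i) j)
       ((act (sg (bL 0) 1) ^^ i) ((act (sg (bH 0) 1) ^^ j) v)))"

end

theory Submission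
  imports Defs
begin

text \<open>Every generator acts by weighted translations, that is, by operators
  \<open>f \<mapsto> w(x, y) f(x + a, y)\<close> for a polynomial weight \<open>w\<close>; the odd ones also rename the variables
  \<open>x, y\<close> to \<open>s, t\<close> or back. Translations are ring homomorphisms, so the product of the
  operators \<open>(w, a)\<close> and \<open>(w', b)\<close> is the weighted translation with weight \<open>w(x, y) w'(x + a, y)\<close>
  by \<open>a + b\<close>, and the supercommutator of two of them is again a weighted translation by \<open>a + b\<close>.
  Each bracket relation thereby becomes an identity between weights in \<open>\<complex>[x, y]\<close>. The powers of
  \<open>\<lambda>\<close> on its two sides agree since \<open>\<lambda> \<noteq> 0\<close> makes the power a homomorphism in the exponent. For
  two generators \<open>L\<^sub>m\<close>, \<open>L\<^sub>n\<close> the identity is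

    \<open>(x + m b)(x + m + n b) - (x + n b)(x + n + m b) = (m - n)(x + (m + n) b)\<close>

  with \<open>b = \<beta>(y)\<close> on even and \<open>b = \<beta>(y) + 1/2\<close> on odd elements. The relation for \<open>G\<^sub>p\<close>, \<open>G\<^sub>q\<close>
  explains the difference of \<open>1/2\<close>: on even elements the weights add up to
  \<open>(x + 2 p \<beta>) + (x + 2 q \<beta>) = 2 (x + (p + q) \<beta>)\<close>, whereas on odd elements the factor
  applied last translates the weight of the other, and they add up to

    \<open>(s + p + 2 q \<beta>) + (s + q + 2 p \<beta>) = 2 (s + (p + q)(\<beta> + 1/2))\<close>.

  No cocycle arises in these identities, which is consistent with all \<open>C\<^sub>i\<close> acting by zero. The
  bracket and the action are bilinear, so it suffices to check the relations on basis elements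
  (lemma \<open>basis_act_bracket\<close>).

  Freeness concerns only \<open>L\<^sub>0\<close> and \<open>H\<^sub>0\<close>, which translate by \<open>0\<close>: they multiply by the first and by
  the second variable, on even and odd elements alike. Hence a polynomial \<open>P\<close> in \<open>L\<^sub>0\<close> and \<open>H\<^sub>0\<close> acts
  as multiplication by \<open>P\<close> itself (lemma \<open>Uh_act_eq_mult\<close>), and the module is the direct sum of two
  copies of the polynomial ring, with basis \<open>(1, 0)\<close>, \<open>(0, 1)\<close>.\<close>

section \<open>Scalars and translations in two-variable polynomials\<close>

definition cst :: "complex \<Rightarrow> poly2" where
  "cst c = [:[:c:]:]"

lemma cst_add: "cst (a + b) = cst a + cst b"
  and cst_diff: "cst (a - b) = cst a - cst b"
  and cst_minus: "cst (- a) = - cst a"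
  and cst_mult: "cst (a * b) = cst a * cst b"
  and cst_0: "cst 0 = 0"
  and cst_1: "cst 1 = 1"
  by (simp_all add: cst_def one_pCons)

lemma cst_of_int: "cst (of_int n) = of_int n"
  by (simp add: cst_def of_int_poly)

lemma cst_numeral: "cst (numeral n) = numeral n"
  by (simp add: cst_def numeral_poly)

text \<open>Clearing the only denominator. The second equation is the first one in the right-nested form
  in which products are normalised.\<close>

lemma cst_one_half: "2 * cst (1 / 2) = 1" "2 * (cst (1 / 2) * f) = f"
proof -
  show *: "2 * cst (1 / 2) = 1"
    using cst_mult[of 2 "1 / 2"] by (simp add: cst_1 cst_numeral)
  show "2 * (cst (1 / 2) * f) = f"
    using * by (simp flip: mult.assoc)
qed

lemma cst_half: "cst (half k) = of_int k + cst (1 / 2)"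
  by (simp add: half_def cst_add cst_of_int)

lemma cst_of_int_half: "cst (of_int m / 2) = of_int m * cst (1 / 2)"
  using cst_mult[of "of_int m" "1 / 2"] by (simp add: cst_of_int)

lemmas cst_simps = cst_add cst_diff cst_minus cst_mult cst_0 cst_1 cst_of_int cst_numeral
  cst_one_half cst_half cst_of_int_half

lemma cmul_eq: "cmul c f = cst c * f"
  by (simp add: cmul_def cst_def)

lemma shift_add: "shift a (f + g) = shift a f + shift a g"
  and shift_mult: "shift a (f * g) = shift a f * shift a g"
  and shift_0: "shift a 0 = 0"
  and shift_1: "shift a 1 = 1"
  and shift_const: "shift a [:b:] = [:b:]"
  and shift_cst: "shift a (cst c) = cst c"
  and shift_of_int: "shift a (of_int n) = of_int n"
  and shift_numeral: "shift a (numeral k) = numeral k"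
  and shift_var1: "shift a var1 = var1 + cst a"
  and shift_var2: "shift a var2 = var2"
  by (simp_all add: shift_def pcompose_add pcompose_mult cst_def var1_def var2_def pcompose_pCons
      of_int_poly numeral_poly one_pCons)

lemma shift_shift: "shift a (shift b f) = shift (a + b) f"
  by (simp add: shift_def pcompose_assoc[symmetric] pcompose_add pcompose_pCons var1_def add_ac)

lemma shift_by_0: "shift 0 f = f"
  by (simp add: shift_def var1_def)

lemmas shift_simps = shift_add shift_mult shift_0 shift_1 shift_const shift_cst shift_of_int
  shift_numeral shift_var1 shift_var2 shift_shift

section \<open>Bilinearity and grading of the action\<close>

lemma vector_space_mod_scale: "vector_space mod_scale"
  by unfold_locales (simp_all add: mod_scale_def cmul_eq cst_simps algebra_simps)

interpretation mv: vector_space mod_scale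
  by (rule vector_space_mod_scale)

(* The rules for products with constant polynomials would replace factors [:\<beta>:] by scalar
   multiplications, which ring normalisation does not distribute. *)
lemma basis_act_add: "basis_act lam \<beta> a (v + w) = basis_act lam \<beta> a v + basis_act lam \<beta> a w"
  by (cases a; cases v; cases w)
    (simp_all add: cmul_eq shift_add algebra_simps del: mult_pCons_left mult_pCons_right)

lemma basis_act_scale: "basis_act lam \<beta> a (mod_scale c v) = mod_scale c (basis_act lam \<beta> a v)"
  by (cases a; cases v)
    (simp_all add: mod_scale_def cmul_eq shift_mult shift_cst algebra_simps)

text \<open>Summing over a larger index set lets the actions of two elements be added termwise although
  their supports differ.\<close>

lemma hv_act_superset:
  assumes "finite A" "Poly_Mapping.keys u \<subseteq> A"
  shows "hv_act lam \<beta> u v = (\<Sum>a\<in>A. mod_scale (Poly_Mapping.lookup u a) (basis_act lam \<beta> a v))"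
  unfolding hv_act_def using assms
  by (intro sum.mono_neutral_left) (auto simp: in_keys_iff)

lemma hv_act_single: "hv_act lam \<beta> (sg a c) v = mod_scale c (basis_act lam \<beta> a v)"
  by (simp add: hv_act_superset[of "{a}"])

lemma hv_act_add_left: "hv_act lam \<beta> (u + u') v = hv_act lam \<beta> u v + hv_act lam \<beta> u' v"
  using Poly_Mapping.keys_add[of u u']
  by (simp add: hv_act_superset[of "Poly_Mapping.keys u \<union> Poly_Mapping.keys u'"] lookup_add
      mv.scale_left_distrib sum.distrib)

lemma hv_act_scale_left: "hv_act lam \<beta> (hv_scale c u) v = mod_scale c (hv_act lam \<beta> u v)"
  by (simp add: hv_act_superset[of "Poly_Mapping.keys u"] keys_hv_scale mv.scale_sum_right)

lemma hv_act_add_right: "hv_act lam \<beta> u (v + w) = hv_act lam \<beta> u v + hv_act lam \<beta> u w"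
  by (simp add: hv_act_def basis_act_add mv.scale_right_distrib sum.distrib)

lemma hv_act_scale_right: "hv_act lam \<beta> u (mod_scale c v) = mod_scale c (hv_act lam \<beta> u v)"
  by (simp add: hv_act_def basis_act_scale mv.scale_sum_right mult.commute)

interpretation hv_act_left: additive "\<lambda>u. hv_act lam \<beta> u v" for lam \<beta> v
  by unfold_locales (rule hv_act_add_left)

interpretation hv_act_right: additive "hv_act lam \<beta> u" for lam \<beta> u
  by unfold_locales (rule hv_act_add_right)

lemma subspace_mod_part: "mv.subspace (mod_part i)"
  by (rule mv.subspaceI)
    (auto simp: mod_part_def mod_scale_def cmul_def zero_prod_def split: if_splits)

lemma superspace_mod: "superspace mod_scale mod_part"
proof (intro superspace.intro superspace_axioms.intro)
  show "mod_part 0 \<inter> mod_part 1 = {0}"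
    by (auto simp: mod_part_def zero_prod_def)
  show "\<exists>a\<in>mod_part 0. \<exists>b\<in>mod_part 1. x = a + b" for x
    by (cases x) (simp add: mod_part_def)
qed (fact vector_space_mod_scale subspace_mod_part)+

lemma basis_act_graded:
  assumes "v \<in> mod_part j"
  shows "basis_act lam \<beta> a v \<in> mod_part (basis_parity a + j)"
  using assms by (cases a; cases v) (auto simp: mod_part_def shift_0 cmul_def split: if_splits)

lemma hv_act_graded:
  assumes "x \<in> hv_part i" "v \<in> mod_part j"
  shows "hv_act lam \<beta> x v \<in> mod_part (i + j)"
  unfolding hv_act_def
proof (rule mv.subspace_sum[OF subspace_mod_part])
  fix a assume "a \<in> Poly_Mapping.keys x"
  then have "basis_parity a = i"
    using assms(1) by (simp add: hv_part_def)
  then show "mod_scale (Poly_Mapping.lookup x a) (basis_act lam \<beta> a v) \<in> mod_part (i + j)"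
    using basis_act_graded[OF assms(2)] mv.subspace_scale[OF subspace_mod_part] by blast
qed

section \<open>Bracket relations\<close>

text \<open>After moving all translations inwards, every term is a weight times the same translate of \<open>f\<close>
  or \<open>g\<close>, and what remains is the identity between the weights in each of the 49 combinations of
  generator types.\<close>

lemma basis_act_bracket:
  assumes "lam \<noteq> 0"
  shows "hv_act lam \<beta> (basis_bracket a b) v =
     basis_act lam \<beta> a (basis_act lam \<beta> b v) -
     mod_scale (koszul_sign (basis_parity a) (basis_parity b))
       (basis_act lam \<beta> b (basis_act lam \<beta> a v))"
proof -
  (* Opaque names keep the simplifier from taking the constants beta and lam powi m apart. *)
  define B where "B = [:\<beta>:]"
  define P where "P m = cst (lam powi m)" for m
  have P_add: "P (m + n) = P m * P n" for m n
    using assms by (simp add: P_def power_int_add cst_mult)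
  have shift_BP: "shift c B = B" "shift c (P m) = P m" for c m
    by (simp_all add: B_def P_def shift_const shift_cst)
  show ?thesis
    apply (cases v; cases a; cases b)
    apply (simp_all only: basis_bracket.simps basis_parity.simps basis_act.simps)
    apply (simp_all add: hv_act_left.add hv_act_left.minus hv_act_left.diff hv_act_left.zero
      hv_act_single when_def if_distrib[of "\<lambda>u. hv_act lam \<beta> u v" for v] mod_scale_def
      koszul_sign_def cmul_eq shift_simps shift_BP cst_simps P_add
      B_def[symmetric] cst_def[symmetric] P_def[symmetric]
      cong: if_cong del: mult_pCons_left mult_pCons_right)
    apply (simp_all add: half_def algebra_simps cst_one_half zero_prod_def)
    done
qed

lemma hv_act_bracket:
  assumes "lam \<noteq> 0" "x \<in> hv_part i" "y \<in> hv_part j"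
  shows "hv_act lam \<beta> (hv_bracket x y) v =
     hv_act lam \<beta> x (hv_act lam \<beta> y v) -
     mod_scale (koszul_sign i j) (hv_act lam \<beta> y (hv_act lam \<beta> x v))"
  using assms(2)
proof (induction rule: hv_part_induct)
  case (single a c)
  show ?case
    using assms(3)
  proof (induction rule: hv_part_induct)
    case (single b d)
    show ?case
      using basis_act_bracket[OF assms(1), of \<beta> a b v] \<open>basis_parity a = i\<close> \<open>basis_parity b = j\<close>
      by (simp add: hv_act_single hv_act_scale_left basis_act_scale mv.scale_right_diff_distrib
          mult_ac)
  qed (simp_all add: hv_bracket_linear hv_act_add_left hv_act_add_right hv_act_left.zero
      hv_act_right.zero mv.scale_right_distrib del: hv_scale_single)
qed (simp_all add: hv_bracket_linear hv_act_add_left hv_act_add_right hv_act_left.zero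
    hv_act_right.zero mv.scale_right_distrib)

theorem lie_superalgebra_module_hv_act:
  assumes "lam \<noteq> 0"
  shows "lie_superalgebra_module hv_scale hv_part hv_bracket mod_scale mod_part (hv_act lam \<beta>)"
proof (intro lie_superalgebra_module.intro lie_superalgebra_module_axioms.intro)
  show "Vector_Spaces.linear hv_scale mod_scale (\<lambda>x. hv_act lam \<beta> x v)" for v
    by unfold_locales (simp_all add: hv_act_add_left hv_act_scale_left)
  show "Vector_Spaces.linear mod_scale mod_scale (hv_act lam \<beta> x)" for x
    by unfold_locales (simp_all add: hv_act_add_right hv_act_scale_right)
qed (fact lie_superalgebra_hv superspace_mod | erule (1) hv_act_graded
  | erule (1) hv_act_bracket[OF assms])+

section \<open>Freeness over the enveloping algebra of the degree-zero part\<close>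

lemma poly2_expand:
  "P = (\<Sum>i\<le>degree P. \<Sum>j\<le>degree (coeff P i).
     cst (coeff (coeff P i) j) * (var1 ^ i * var2 ^ j))"
proof -
  have inner: "[:monom c j:] = cst c * var2 ^ j" for c j
  proof (induction j)
    case (Suc j)
    have "[:monom c (Suc j):] = var2 * [:monom c j:]"
      by (simp add: var2_def monom_Suc)
    then show ?case
      using Suc by (simp add: mult_ac)
  qed (simp add: cst_def monom_0)
  have "P = (\<Sum>i\<le>degree P. [:coeff P i:] * var1 ^ i)"
    using poly_as_sum_of_monoms[of P] by (simp add: var1_def monom_altdef)
  also have "\<dots> = (\<Sum>i\<le>degree P.
      [:\<Sum>j\<le>degree (coeff P i). monom (coeff (coeff P i) j) j:] * var1 ^ i)"
    by (simp only: poly_as_sum_of_monoms)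
  also have "\<dots> = (\<Sum>i\<le>degree P. \<Sum>j\<le>degree (coeff P i).
      cst (coeff (coeff P i) j) * (var1 ^ i * var2 ^ j))"
    by (simp add: sum_to_poly[symmetric] inner sum_distrib_right sum_distrib_left mult_ac
        del: mult_pCons_left mult_pCons_right)
  finally show ?thesis .
qed

lemma L0_act_funpow: "(hv_act lam \<beta> (sg (bL 0) 1) ^^ i) (f, g) = (var1 ^ i * f, var1 ^ i * g)"
  by (induction i) (simp_all add: hv_act_single cmul_eq cst_0 cst_1 shift_by_0 mult_ac)

lemma H0_act_funpow: "(hv_act lam \<beta> (sg (bH 0) 1) ^^ i) (f, g) = (var2 ^ i * f, var2 ^ i * g)"
  by (induction i) (simp_all add: hv_act_single cmul_eq cst_0 cst_1 shift_by_0 mult_ac)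

lemma sum_Pair: "(\<Sum>i\<in>A. (f i, g i)) = (sum f A, sum g A)"
  by (rule prod_eqI) (simp_all add: fst_sum snd_sum)

text \<open>Evaluation of \<open>P\<close> at \<open>L\<^sub>0\<close> and \<open>H\<^sub>0\<close> is evaluation at the operators of multiplication by the
  two variables, which returns multiplication by \<open>P\<close>.\<close>

lemma Uh_act_eq_mult: "Uh_act mod_scale (hv_act lam \<beta>) P (f, g) = (P * f, P * g)"
proof -
  let ?c = "\<lambda>i j. cst (coeff (coeff P i) j)"
  have "Uh_act mod_scale (hv_act lam \<beta>) P (f, g) =
    ((\<Sum>i\<le>degree P. \<Sum>j\<le>degree (coeff P i). ?c i j * (var1 ^ i * var2 ^ j)) * f,
     (\<Sum>i\<le>degree P. \<Sum>j\<le>degree (coeff P i). ?c i j * (var1 ^ i * var2 ^ j)) * g)"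
    by (simp add: Uh_act_def L0_act_funpow H0_act_funpow mod_scale_def cmul_eq sum_Pair
        sum_distrib_right sum_distrib_left mult_ac)
  then show ?thesis
    by (simp only: poly2_expand[symmetric])
qed

theorem free_of_rank_Uh_act: "free_of_rank (Uh_act mod_scale (hv_act lam \<beta>)) 2"
proof -
  let ?s = "Uh_act mod_scale (hv_act lam \<beta>)"
  interpret U: module ?s
    by unfold_locales (auto simp: Uh_act_eq_mult algebra_simps)
  let ?B = "{(1, 0), (0, 1)} :: (poly2 \<times> poly2) set"
  have "\<not> U.dependent ?B"
    by (auto simp: U.dependent_finite Uh_act_eq_mult zero_prod_def)
  moreover have "v \<in> U.span ?B" for v
  proof -
    obtain f g where v: "v = (f, g)"
      by fastforce
    have "?s f (1, 0) + ?s g (0, 1) \<in> U.span ?B"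
      by (intro U.span_add U.span_scale U.span_base) auto
    then show ?thesis
      by (simp add: v Uh_act_eq_mult)
  qed
  ultimately show ?thesis
    unfolding free_of_rank_def using U.module_axioms
    by (intro conjI exI[of _ ?B]) auto
qed

section \<open>The module structure and its rank\<close>

theorem proposition2p3:
  fixes lam :: complex and \<beta> :: "complex poly"
  assumes "lam \<noteq> 0"
  shows "lie_superalgebra_module hv_scale hv_part hv_bracket mod_scale mod_part (hv_act lam \<beta>) \<and>
    free_of_rank (Uh_act mod_scale (hv_act lam \<beta>)) 2"
  using lie_superalgebra_module_hv_act[OF assms] free_of_rank_Uh_act by blast

end
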